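(* In the robust peak load pricing model with elastic demand and uncertain variable costs (defined in the context), the optimal robust welfare and the optimal adjustable robust welfare are equal, i.e. $C'_R=C'_{AR}$.
   Context: Let $\mathcal{N}=\{1,\dots,N\}$ (producers) and $\mathcal{T}=\{1,\dots,T\}$ (time periods). Data: investment costs $c^{\mathrm{inv}}_i\ge 0$, nominal variable costs $c^{\mathrm{var}}_i\ge 0$, scaling factors $a_i\ge 0$ ($i\in\mathcal{N}$), strictly decreasing demand functions $p_t:\mathbb{R}\to\mathbb{R}$ ($t\in\mathcal{T}$). The uncertainty set $\mathcal{U}\subseteq[0,1]^{N\times T}$ is a convex polytope with $0\in\mathcal{U}$, whose projection onto every coordinate axis is $[0,1]$, and which is a Cartesian product $\mathcal{U}=\prod_{t\in\mathcal{T}}\mathcal{U}'$ for some $\mathcal{U}'\subseteq[0,1]^N$. For $y\in\mathbb{R}^N_{\ge 0}$ let $F(y)=\{x\in\mathbb{R}^{N\times T}_{\ge 0} : x_{i,t}\le y_i\ \forall i,t\}$. Write $\bar x_t=\sum_{i\in\mathcal{N}}x_{i,t}$ and $$W(x,y,u)=\sum_{t\in\mathcal{T}}\int_0^{\bar x_t}p_t(s)\,ds-\sum_{i\in\mathcal{N}}\Big(c^{\mathrm{inv}}_iy_i+\sum_{t\in\mathcal{T}}(c^{\mathrm{var}}_i+a_iu_{i,t})x_{i,t}\Big).$$ Robust welfare: $C'_R:=\max_{y\ge 0,\ x\in F(y)}\ \min_{u\in\mathcal{U}}W(x,y,u)$. Adjustable robust welfare: $C'_{AR}:=\max_{y\ge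 0}\ \min_{u\in\mathcal{U}}\ \max_{x\in F(y)}W(x,y,u)$. The outer maxima over $y$ are read as suprema in $\mathbb{R}\cup\{+\infty\}$ if not attained. *)

theory Defs
  imports "HOL-Analysis.Analysis"
begin

text \<open>
  Producers are indexed by the finite type \<open>'n\<close> and time periods by the finite type \<open>'t\<close>, so
  \<open>real ^ 't ^ 'n\<close> is the space of \<open>N \<times> T\<close> matrices, with \<open>x $ i $ t\<close> the entry \<open>x\<^sub>i\<^sub>,\<^sub>t\<close>.
\<close>

definition investments :: "(real ^ 'n) set"
  where "investments = {y. \<forall>i. 0 \<le> y $ i}"

definition feasible :: "real ^ 'n \<Rightarrow> (real ^ 't ^ 'n) set"
  where "feasible y = {x. \<forall>i t. 0 \<le> x $ i $ t \<and> x $ i $ t \<le> y $ i}"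

definition total_production :: "real ^ 't ^ 'n \<Rightarrow> 't \<Rightarrow> real"
  where "total_production x t = (\<Sum>i\<in>UNIV. x $ i $ t)"

text \<open>
  For \<open>x \<in> feasible y\<close> the upper limit of integration is nonnegative, so the set integral below is
  the oriented integral from \<open>0\<close>; it exists because each \<open>p t\<close> is monotone.
\<close>

definition welfare ::
  "('n \<Rightarrow> real) \<Rightarrow> ('n \<Rightarrow> real) \<Rightarrow> ('n \<Rightarrow> real) \<Rightarrow> ('t \<Rightarrow> real \<Rightarrow> real) \<Rightarrow>
    real ^ 't ^ 'n \<Rightarrow> real ^ 'n \<Rightarrow> real ^ 't ^ 'n \<Rightarrow> real"
  where "welfare c_inv c_var a p x y u =
    (\<Sum>t\<in>UNIV. integral {0..total_production x t} (p t))
    - (\<Sum>i\<in>UNIV. c_inv i * y $ i + (\<Sum>t\<in>UNIV. (c_var i + a i * u $ i $ t) * x $ i $ t))"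

text \<open>
  The optimal values live in \<open>ereal\<close> because the outer maximum over \<open>y\<close> may be an unattained or
  infinite supremum. For a nonempty polytope \<open>U\<close>, the inner extrema over \<open>U\<close> and \<open>feasible y\<close> are
  extrema of continuous functions over nonempty compact sets, so there \<open>INF\<close> and \<open>SUP\<close> are the
  minimum and maximum.
\<close>

definition robust_welfare ::
  "('n \<Rightarrow> real) \<Rightarrow> ('n \<Rightarrow> real) \<Rightarrow> ('n \<Rightarrow> real) \<Rightarrow> ('t \<Rightarrow> real \<Rightarrow> real) \<Rightarrow>
    (real ^ 't ^ 'n) set \<Rightarrow> ereal"
  where "robust_welfare c_inv c_var a p U =
    (SUP (y, x) \<in> Sigma investments feasible.
      INF u \<in> U. ereal (welfare c_inv c_var a p x y u))"

definition adjustable_robust_welfare ::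
  "('n \<Rightarrow> real) \<Rightarrow> ('n \<Rightarrow> real) \<Rightarrow> ('n \<Rightarrow> real) \<Rightarrow> ('t \<Rightarrow> real \<Rightarrow> real) \<Rightarrow>
    (real ^ 't ^ 'n) set \<Rightarrow> ereal"
  where "adjustable_robust_welfare c_inv c_var a p U =
    (SUP y \<in> investments. INF u \<in> U. SUP x \<in> feasible y.
      ereal (welfare c_inv c_var a p x y u))"

end

theory Submission
  imports Defs
begin

text \<open>
  For fixed \<open>y\<close> the welfare is concave in \<open>x\<close>, because the integral of a decreasing function is
  concave, and affine in \<open>u\<close>. A minimax theorem therefore exchanges the extrema over \<open>x\<close> and \<open>u\<close>
  for each \<open>y\<close> separately. As the payoff has the form \<open>g x - b x \<bullet> u\<close> with \<open>b\<close> linear, it is enough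
  to separate the convex set of pairs \<open>(r, b x)\<close> with \<open>r \<le> g x\<close> from the convex set of pairs
  \<open>(r, w)\<close> on which \<open>r - w \<bullet> u \<ge> c\<close> for all \<open>u\<close>: the slope of the separating hyperplane is the
  required worst case \<open>u\<close>.
\<close>

section \<open>Minimax by separation of convex sets\<close>

lemma minimax_concave_affine:
  fixes X :: "'a::real_vector set" and U :: "'b::euclidean_space set"
  assumes g: "concave_on X g" and b: "linear b" and "X \<noteq> {}"
    and U: "compact U" "convex U" "U \<noteq> {}"
    and less: "\<And>x. x \<in> X \<Longrightarrow> \<exists>u\<in>U. g x - b x \<bullet> u < c"
  shows "\<exists>u\<in>U. \<forall>x\<in>X. g x - b x \<bullet> u \<le> c"
proof -
  define C where "C = {(r, w). \<exists>x\<in>X. r \<le> g x \<and> w = b x}"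
  define D where "D = {(r, w). \<forall>u\<in>U. c \<le> r - w \<bullet> u}"
  interpret b: linear b by fact
  have "convex X" using g by (simp add: concave_on_iff)
  have "convex C"
  proof (rule convexI)
    fix p q :: "real \<times> 'b" and s t :: real
    assume "p \<in> C" "q \<in> C" and st: "0 \<le> s" "0 \<le> t" "s + t = 1"
    then obtain x y where xy: "x \<in> X" "y \<in> X"
      "fst p \<le> g x" "snd p = b x" "fst q \<le> g y" "snd q = b y"
      unfolding C_def by auto
    have "s * fst p + t * fst q \<le> s * g x + t * g y"
      using st xy by (intro add_mono mult_left_mono) auto
    also have "\<dots> \<le> g (s *\<^sub>R x + t *\<^sub>R y)"
      using g st xy by (simp add: concave_on_iff)
    finally show "s *\<^sub>R p + t *\<^sub>R q \<in> C"
      using convexD[OF \<open>convex X\<close> xy(1,2) st] xy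
      by (auto simp: C_def prod_eq_iff b.add b.scale split: prod.splits
          intro!: bexI[of _ "s *\<^sub>R x + t *\<^sub>R y"])
  qed
  moreover have "convex D"
  proof (rule convexI)
    fix p q :: "real \<times> 'b" and s t :: real
    assume D: "p \<in> D" "q \<in> D" and st: "0 \<le> s" "0 \<le> t" "s + t = 1"
    show "s *\<^sub>R p + t *\<^sub>R q \<in> D"
      unfolding D_def
    proof (clarsimp simp: case_prod_beta)
      fix u assume "u \<in> U"
      then have "c \<le> fst p - snd p \<bullet> u" "c \<le> fst q - snd q \<bullet> u"
        using D by (auto simp: D_def)
      then have "s * c + t * c \<le> s * (fst p - snd p \<bullet> u) + t * (fst q - snd q \<bullet> u)"
        using st by (intro add_mono mult_left_mono) auto
      moreover have "s * c + t * c = c" using st by (metis distrib_right mult_1)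
      ultimately show "c \<le> s * fst p + t * fst q - (s *\<^sub>R snd p + t *\<^sub>R snd q) \<bullet> u"
        by (simp add: algebra_simps)
    qed
  qed
  moreover have "C \<noteq> {}"
    using \<open>X \<noteq> {}\<close> by (auto simp: C_def)
  moreover have "C \<inter> D = {}"
    using less by (fastforce simp: C_def D_def)
  \<comment> \<open>By compactness some \<open>u\<close> in \<open>U\<close> maximizes
    \<open>w \<bullet> u\<close>, so this is the lowest point of \<open>D\<close> over
    \<open>w\<close>. It bounds the separating functional through the support function of
    \<open>U\<close>.\<close>
  moreover have epi: "\<exists>u\<in>U. (c + w \<bullet> u, w) \<in> D" for w
  proof -
    have "continuous_on U ((\<bullet>) w)" by (intro continuous_intros)
    then obtain u where "u \<in> U" "\<forall>v\<in>U. w \<bullet> v \<le> w \<bullet> u"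
      using continuous_attains_sup U by metis
    then show ?thesis by (auto simp: D_def intro!: bexI[of _ u])
  qed
  moreover from epi[of 0] have "D \<noteq> {}" by auto
  ultimately obtain n \<gamma> where "n \<noteq> 0"
    and nC: "\<forall>z\<in>C. n \<bullet> z \<le> \<gamma>" and nD: "\<forall>z\<in>D. \<gamma> \<le> n \<bullet> z"
    using separating_hyperplane_sets[of C D] by auto
  obtain \<alpha> \<beta> where n: "n = (\<alpha>, \<beta>)" by fastforce
  have D_ge: "\<exists>u\<in>U. \<gamma> \<le> \<alpha> * (c + w \<bullet> u) + \<beta> \<bullet> w" for w
    using epi[of w] nD by (force simp: n)
  have C_le: "\<alpha> * g x + \<beta> \<bullet> b x \<le> \<gamma>" if "x \<in> X" for x
    using nC that by (force simp: n C_def)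
  \<comment> \<open>\<open>C\<close> is unbounded downwards in its first coordinate, so a negative
    \<open>\<alpha>\<close> would make the functional unbounded above on \<open>C\<close>; the
    \<open>s\<close> below pushes it past \<open>\<gamma>\<close>.\<close>
  have "0 \<le> \<alpha>"
  proof (rule ccontr)
    assume neg: "\<not> 0 \<le> \<alpha>"
    obtain x where x: "x \<in> X" using \<open>X \<noteq> {}\<close> by auto
    have *: "\<alpha> * (g x - s) + \<beta> \<bullet> b x \<le> \<gamma>" if "0 \<le> s" for s
    proof -
      have "(g x - s, b x) \<in> C" using x that by (auto simp: C_def intro!: bexI[of _ x])
      then show ?thesis using nC by (force simp: n)
    qed
    define s where "s = (\<bar>\<gamma> - \<alpha> * g x - \<beta> \<bullet> b x\<bar> + 1) / - \<alpha>"
    have "0 \<le> s" unfolding s_def using neg by (intro divide_nonneg_nonneg) auto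
    moreover have "\<alpha> * s = - (\<bar>\<gamma> - \<alpha> * g x - \<beta> \<bullet> b x\<bar> + 1)"
      using neg by (simp add: s_def)
    ultimately show False using *[of s] by (simp add: algebra_simps)
  qed
  \<comment> \<open>A vertical hyperplane is impossible: \<open>D\<close> has a point over every
    \<open>w\<close>, so \<open>\<beta> \<bullet> w\<close> would be bounded below on the whole
    space.\<close>
  moreover have "\<alpha> \<noteq> 0"
  proof
    assume [simp]: "\<alpha> = 0"
    then have "\<beta> \<noteq> 0" using \<open>n \<noteq> 0\<close> n by (auto simp: zero_prod_def)
    define s where "s = (\<gamma> - 1) / (\<beta> \<bullet> \<beta>)"
    have "\<gamma> \<le> \<beta> \<bullet> (s *\<^sub>R \<beta>)"
      using D_ge[of "s *\<^sub>R \<beta>"] by simp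
    then show False using \<open>\<beta> \<noteq> 0\<close> by (simp add: s_def)
  qed
  ultimately have \<alpha>: "0 < \<alpha>" by simp
  \<comment> \<open>Dividing by \<open>\<alpha>\<close> turns the functional into
    \<open>r - w \<bullet> v\<close>, the payoff at the cost vector \<open>v\<close>. This
    \<open>v\<close> is the candidate worst case.\<close>
  define v where "v = - (1 / \<alpha>) *\<^sub>R \<beta>"
  have \<beta>: "\<beta> = - \<alpha> *\<^sub>R v" using \<alpha> by (simp add: v_def)
  have support: "\<exists>u\<in>U. \<gamma> - \<alpha> * c \<le> \<alpha> * (w \<bullet> (u - v))" for w
    using D_ge[of w] by (simp add: \<beta> algebra_simps inner_commute)
  have "\<gamma> \<le> \<alpha> * c" using support[of 0] by auto
  \<comment> \<open>If \<open>v\<close> could be separated from \<open>U\<close>, scaling the normal would violate \<open>support\<close>.\<close>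
  have "v \<in> U"
  proof (rule ccontr)
    assume "v \<notin> U"
    then obtain w d where w: "w \<bullet> v < d" "\<forall>u\<in>U. d < w \<bullet> u"
      using separating_hyperplane_closed_point[of U v] U compact_imp_closed by blast
    define \<epsilon> where "\<epsilon> = \<alpha> * (d - w \<bullet> v)"
    have "0 < \<epsilon>" using w \<alpha> by (simp add: \<epsilon>_def)
    \<comment> \<open>Used with the normal \<open>- s *\<^sub>R w\<close>: the right-hand side of
      \<open>support\<close> is then at most \<open>- s * \<epsilon>\<close>, which lies one below
      \<open>\<gamma> - \<alpha> * c\<close>.\<close>
    define s where "s = (\<alpha> * c - \<gamma> + 1) / \<epsilon>"
    have s: "0 < s" using \<open>0 < \<epsilon>\<close> \<open>\<gamma> \<le> \<alpha> * c\<close> by (simp add: s_def)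
    obtain u where u: "u \<in> U" "\<gamma> - \<alpha> * c \<le> \<alpha> * (- s *\<^sub>R w \<bullet> (u - v))"
      using support by blast
    have "d - w \<bullet> v \<le> w \<bullet> (u - v)" using w u by (auto simp: inner_diff_right less_imp_le)
    then have "s * \<epsilon> \<le> s * (\<alpha> * (w \<bullet> (u - v)))"
      unfolding \<epsilon>_def using \<alpha> s by (intro mult_left_mono) auto
    moreover have "s * \<epsilon> = \<alpha> * c - \<gamma> + 1" using \<open>0 < \<epsilon>\<close> by (simp add: s_def)
    ultimately show False using u(2) by (simp add: algebra_simps)
  qed
  moreover have "g x - b x \<bullet> v \<le> c" if "x \<in> X" for x
  proof -
    have "\<alpha> * (g x - b x \<bullet> v) \<le> \<alpha> * c"
      using C_le[OF that] \<open>\<gamma> \<le> \<alpha> * c\<close> by (simp add: \<beta> algebra_simps inner_commute)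
    then show ?thesis using \<alpha> by simp
  qed
  ultimately show ?thesis by blast
qed

section \<open>Concavity of integrals of decreasing functions\<close>

text \<open>The value \<open>f r\<close> bounds \<open>f\<close> from above to the right of
  \<open>r\<close> and from below to the left, so it is a supergradient of the integral at
  \<open>r\<close>, even where \<open>f\<close> jumps.\<close>

lemma integral_antimono_le_supergradient:
  fixes f :: "real \<Rightarrow> real"
  assumes f: "antimono f" and "0 \<le> r" "0 \<le> s"
  shows "integral {0..s} f \<le> integral {0..r} f + f r * (s - r)"
proof -
  have int: "f integrable_on {x..y}" for x y
  proof -
    have "(\<lambda>s. - f s) integrable_on {x..y}"
      using f by (intro integrable_on_mono_on) (auto simp: monotone_on_def antimono_def)
    then show ?thesis by (simp add: integrable_neg_iff)
  qed
  show ?thesis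
  proof (cases "r \<le> s")
    case True
    have "integral {0..s} f = integral {0..r} f + integral {r..s} f"
      using Henstock_Kurzweil_Integration.integral_combine[OF \<open>0 \<le> r\<close> True int] by simp
    moreover have "integral {r..s} f \<le> integral {r..s} (\<lambda>_. f r)"
      using f by (intro integral_le int) (auto simp: antimono_def)
    ultimately show ?thesis using True by (simp add: algebra_simps)
  next
    case False
    then have "integral {0..r} f = integral {0..s} f + integral {s..r} f"
      using Henstock_Kurzweil_Integration.integral_combine[OF \<open>0 \<le> s\<close> _ int, of r] by simp
    moreover have "integral {s..r} (\<lambda>_. f r) \<le> integral {s..r} f"
      using f by (intro integral_le int) (auto simp: antimono_def)
    ultimately show ?thesis using False by (simp add: algebra_simps)
  qed
qed

lemma concave_on_integral_antimono:
  fixes f :: "real \<Rightarrow> real"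
  assumes "antimono f"
  shows "concave_on {0..} (\<lambda>s. integral {0..s} f)"
  unfolding concave_on_iff
proof (intro conjI ballI allI impI)
  fix x y \<mu> \<nu> :: real
  assume xy: "x \<in> {0..}" "y \<in> {0..}" and \<mu>\<nu>: "0 \<le> \<mu>" "0 \<le> \<nu>" "\<mu> + \<nu> = 1"
  define r where "r = \<mu> *\<^sub>R x + \<nu> *\<^sub>R y"
  define I where "I = (\<lambda>s. integral {0..s} f)"
  have "0 \<le> r" using xy \<mu>\<nu> by (simp add: r_def)
  \<comment> \<open>Both supergradient bounds are taken at the convex combination \<open>r\<close>,
    where their weighted slope terms cancel because \<open>\<mu> + \<nu> = 1\<close>.\<close>
  then have "\<mu> * I x + \<nu> * I y \<le> \<mu> * (I r + f r * (x - r)) + \<nu> * (I r + f r * (y - r))"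
    unfolding I_def using integral_antimono_le_supergradient[OF assms \<open>0 \<le> r\<close>] xy \<mu>\<nu>
    by (intro add_mono mult_left_mono) auto
  also have "\<dots> = (\<mu> + \<nu>) * I r + f r * (r - (\<mu> + \<nu>) * r)"
    by (simp add: r_def algebra_simps)
  finally show "\<mu> * integral {0..x} f + \<nu> * integral {0..y} f
      \<le> integral {0..\<mu> *\<^sub>R x + \<nu> *\<^sub>R y} f"
    using \<mu>\<nu> by (simp add: I_def r_def)
qed simp

section \<open>The welfare as a function of production and of uncertain costs\<close>

lemma convex_feasible:
  fixes y :: "real ^ 'n::finite"
  shows "convex (feasible y :: (real ^ 't::finite ^ 'n) set)"
proof (rule convexI)
  fix x z :: "real ^ 't ^ 'n" and s r :: real
  assume xz: "x \<in> feasible y" "z \<in> feasible y" and sr: "0 \<le> s" "0 \<le> r" "s + r = 1"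
  have "s * x $ i $ t + r * z $ i $ t \<le> y $ i" for i t
    using xz sr by (intro convex_bound_le) (auto simp: feasible_def)
  then show "s *\<^sub>R x + r *\<^sub>R z \<in> feasible y"
    using xz sr by (auto simp: feasible_def)
qed

text \<open>Each period contributes a concave function of the total production, which is linear in
  \<open>x\<close> and nonnegative on \<open>feasible y\<close>; the costs subtracted are affine in
  \<open>x\<close>.\<close>

lemma concave_on_welfare:
  fixes p :: "'t::finite \<Rightarrow> real \<Rightarrow> real" and y :: "real ^ 'n::finite"
  assumes "\<And>t. antimono (p t)"
  shows "concave_on (feasible y) (\<lambda>x :: real ^ 't ^ 'n. welfare c_inv c_var a p x y u)"
  unfolding concave_on_iff
proof (intro conjI ballI allI impI convex_feasible)
  fix x z :: "real ^ 't ^ 'n" and s r :: real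
  assume xz: "x \<in> feasible y" "z \<in> feasible y" and sr: "0 \<le> s" "0 \<le> r" "s + r = 1"
  define I where "I = (\<lambda>t (x :: real ^ 't ^ 'n). integral {0..total_production x t} (p t))"
  define K where "K = (\<Sum>i\<in>UNIV. c_inv i * y $ i)"
  define V where "V = (\<lambda>x::real ^ 't ^ 'n.
    \<Sum>i\<in>UNIV. \<Sum>t\<in>UNIV. (c_var i + a i * u $ i $ t) * x $ i $ t)"
  have w: "welfare c_inv c_var a p x y u = (\<Sum>t\<in>UNIV. I t x) - (K + V x)" for x
    by (simp add: welfare_def I_def K_def V_def sum.distrib)
  have nonneg: "0 \<le> total_production x t" if "x \<in> feasible y" for x :: "real ^ 't ^ 'n" and t
    using that by (auto simp: total_production_def feasible_def intro: sum_nonneg)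
  have lin: "total_production (s *\<^sub>R x + r *\<^sub>R z) t
      = s *\<^sub>R total_production x t + r *\<^sub>R total_production z t" for t
    by (simp add: total_production_def sum.distrib sum_distrib_left)
  have "s * I t x + r * I t z \<le> I t (s *\<^sub>R x + r *\<^sub>R z)" for t
    using concave_on_integral_antimono[OF assms, of t] nonneg[OF xz(1)] nonneg[OF xz(2)] sr
    unfolding I_def lin by (auto simp: concave_on_iff)
  then have "(\<Sum>t\<in>UNIV. s * I t x + r * I t z) \<le> (\<Sum>t\<in>UNIV. I t (s *\<^sub>R x + r *\<^sub>R z))"
    by (rule sum_mono)
  moreover have "V (s *\<^sub>R x + r *\<^sub>R z) = s * V x + r * V z"
    by (simp add: V_def sum.distrib sum_distrib_left algebra_simps)
  moreover have "s * K + r * K = K" using sr by (metis distrib_right mult_1)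
  ultimately show "s * welfare c_inv c_var a p x y u + r * welfare c_inv c_var a p z y u
      \<le> welfare c_inv c_var a p (s *\<^sub>R x + r *\<^sub>R z) y u"
    by (simp add: w sum.distrib sum_distrib_left algebra_simps)
qed

text \<open>This is the payoff shape \<open>g x - b x \<bullet> u\<close> of the minimax lemma, with
  \<open>g\<close> the welfare at nominal costs.\<close>

lemma welfare_affine_cost:
  fixes x u :: "real ^ 't::finite ^ 'n::finite"
  shows "welfare c_inv c_var a p x y u =
    welfare c_inv c_var a p x y 0 - (\<chi> i t. a i * x $ i $ t) \<bullet> u"
  by (simp add: welfare_def inner_vec_def sum.distrib algebra_simps)

section \<open>Exchange of the extrema at fixed investments\<close>

theorem theorem5p2:
  fixes c_inv c_var a :: "'n::finite \<Rightarrow> real"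
    and p :: "'t::finite \<Rightarrow> real \<Rightarrow> real"
    and U :: "(real ^ 't ^ 'n) set"
    and U' :: "(real ^ 'n) set"
  assumes c_inv_nonneg: "\<And>i. 0 \<le> c_inv i"
    and c_var_nonneg: "\<And>i. 0 \<le> c_var i"
    and a_nonneg: "\<And>i. 0 \<le> a i"
    and p_decreasing: "\<And>t. strict_antimono_on UNIV (p t)"
    and U_box: "\<And>u i t. u \<in> U \<Longrightarrow> u $ i $ t \<in> {0..1}"
    and U_polytope: "polytope U"
    and U_zero: "0 \<in> U"
    and U_projection: "\<And>i t. (\<lambda>u. u $ i $ t) ` U = {0..1}"
    and U'_box: "\<And>v i. v \<in> U' \<Longrightarrow> v $ i \<in> {0..1}"
    and U_product: "U = {u. \<forall>t. column t u \<in> U'}"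
  shows "robust_welfare c_inv c_var a p U = adjustable_robust_welfare c_inv c_var a p U"
proof -
  let ?W = "welfare c_inv c_var a p"
  have anti: "antimono (p t)" for t
    using p_decreasing[of t]
    by (auto simp: monotone_on_def antimono_def order_le_less)
  have minimax: "(SUP x\<in>feasible y. INF u\<in>U. ereal (?W x y u))
      = (INF u\<in>U. SUP x\<in>feasible y. ereal (?W x y u))"
    if "y \<in> investments" for y :: "real ^ 'n"
  proof (rule antisym)
    show "(SUP x\<in>feasible y. INF u\<in>U. ereal (?W x y u))
        \<le> (INF u\<in>U. SUP x\<in>feasible y. ereal (?W x y u))"
      by (intro SUP_least INF_greatest) (rule order_trans[OF INF_lower SUP_upper])
    show "(INF u\<in>U. SUP x\<in>feasible y. ereal (?W x y u))
        \<le> (SUP x\<in>feasible y. INF u\<in>U. ereal (?W x y u))"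
    proof (rule ccontr)
      assume "\<not> ?thesis"
      \<comment> \<open>A gap between the two extended values contains a real level
        \<open>c\<close>. Its lower side gives each \<open>x\<close> its own \<open>u\<close> with
        payoff below \<open>c\<close>; the minimax lemma makes one \<open>u\<close> serve all
        \<open>x\<close>, which contradicts the upper side.\<close>
      then obtain c where c: "(SUP x\<in>feasible y. INF u\<in>U. ereal (?W x y u)) < ereal c"
          "ereal c < (INF u\<in>U. SUP x\<in>feasible y. ereal (?W x y u))"
        using ereal_dense2 by (meson not_le)
      have less: "\<exists>u\<in>U. ?W x y 0 - (\<chi> i t. a i * x $ i $ t) \<bullet> u < c"
        if "x \<in> feasible y" for x
      proof -
        have "(INF u\<in>U. ereal (?W x y u)) < ereal c"
          using SUP_upper[OF that] c(1) by (rule le_less_trans)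
        then show ?thesis
          by (auto simp: INF_less_iff simp flip: welfare_affine_cost)
      qed
      have lin: "linear (\<lambda>x :: real ^ 't ^ 'n. \<chi> i t. a i * x $ i $ t)"
        by (rule linearI) (simp_all add: vec_eq_iff algebra_simps)
      have "0 \<in> (feasible y :: (real ^ 't ^ 'n) set)"
        using that by (simp add: feasible_def investments_def)
      then have nonempty: "feasible y \<noteq> ({} :: (real ^ 't ^ 'n) set)" by blast
      have U: "compact U" "convex U" "U \<noteq> {}"
        using U_polytope U_zero by (auto intro: polytope_imp_compact polytope_imp_convex)
      obtain u where "u \<in> U"
          and u: "\<forall>x\<in>feasible y. ?W x y 0 - (\<chi> i t. a i * x $ i $ t) \<bullet> u \<le> c"
        using minimax_concave_affine[OF concave_on_welfare[OF anti] lin nonempty U less] by blast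
      have "(SUP x\<in>feasible y. ereal (?W x y u)) \<le> ereal c"
        using u by (auto intro!: SUP_least simp flip: welfare_affine_cost)
      moreover have "ereal c < (SUP x\<in>feasible y. ereal (?W x y u))"
        using c(2) INF_lower[OF \<open>u \<in> U\<close>] by (rule less_le_trans)
      ultimately show False by simp
    qed
  qed
  \<comment> \<open>The joint supremum over \<open>(y, x)\<close> is iterated. Both problems choose
    \<open>y\<close> before \<open>u\<close>, so only the choices of \<open>x\<close> and
    \<open>u\<close> have to be exchanged.\<close>
  have "robust_welfare c_inv c_var a p U
      = (SUP y\<in>investments. SUP x\<in>feasible y. INF u\<in>U. ereal (?W x y u))"
    unfolding robust_welfare_def
    by (rule antisym) (auto intro!: SUP_least intro: SUP_upper2)
  also have "\<dots> = adjustable_robust_welfare c_inv c_var a p U"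
    unfolding adjustable_robust_welfare_def by (intro SUP_cong refl minimax)
  finally show ?thesis .
qed

end
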